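(* Let $Y$ be a locally compact $\sigma$-compact Hausdorff space and $q:Y\to X$ a pure quotient map with $X$ Hausdorff. Then: (i) If $x\in F_q$ is a point of countable tightness in $X$, then $x$ is isolated in $F_q\cup N_q$ and lies in the closure of $L_q$. (ii) If $X$ is countably tight then $N_q$ is closed in $X$, and $F_q$ is discrete and lies in the closure of $L_q$.
   Context: A map $q:Y\to X$ is locally closed at $x\in X$ if for every closed set $W\subseteq Y$, $x\in\overline{q(W)}$ implies $x\in q(W)$. $L_q=\{x\in X: q \text{ is locally closed at } x \text{ and } q^{-1}(x) \text{ has compact boundary}\}$; $F_q=\{x\in X: q \text{ is locally closed at } x \text{ and } q^{-1}(x) \text{ has non-compact boundary}\}$; $N_q=\{x\in X: q \text{ is not locally closed at } x\}$. $X$ has countable tightness at $x\in X$ if for each $A\subseteq X$ with $x\in\overline A$ there is a countable $B\subseteq A$ with $x\in\overline B$; $X$ is countably tight if it has countable tightness at every point. A net in $Y$ converges to $\infty$ if it is eventually outside every compact subset of $Y$. A quotient map $q:Y\to X$ (with $Y$ locally compact $\sigma$-compact Hausdorff, $X$ Hausdorff) is pure if there is a subset $D\subseteq Y$ such that (i) $D$ is dense in $Y$ and $q|_D$ is injective, and (ii) for every net $(d_\alpha)$ in $D$ with $d_\alpha\to\infty$, every net $(e_\alpha)$ in $Y$ (with the same index set) satisfying $q(e_\alpha)=q(d_\alpha)$ for all $\alpha$ also satisfies $e_\alpha\to\infty$. *)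

theory Defs
  imports "HOL-Analysis.Analysis"
begin

definition sigma_compact_space :: "'a topology \<Rightarrow> bool" where
  "sigma_compact_space Y \<longleftrightarrow>
     (\<exists>\<C>. countable \<C> \<and> (\<forall>K\<in>\<C>. compactin Y K) \<and> \<Union>\<C> = topspace Y)"

definition fibre :: "'a topology \<Rightarrow> ('a \<Rightarrow> 'b) \<Rightarrow> 'b \<Rightarrow> 'a set" where
  "fibre Y q x = {y \<in> topspace Y. q y = x}"

definition locally_closed_at :: "'a topology \<Rightarrow> 'b topology \<Rightarrow> ('a \<Rightarrow> 'b) \<Rightarrow> 'b \<Rightarrow> bool" where
  "locally_closed_at Y X q x \<longleftrightarrow>
     (\<forall>W. closedin Y W \<longrightarrow> x \<in> X closure_of (q ` W) \<longrightarrow> x \<in> q ` W)"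

definition L_set :: "'a topology \<Rightarrow> 'b topology \<Rightarrow> ('a \<Rightarrow> 'b) \<Rightarrow> 'b set" where
  "L_set Y X q = {x \<in> topspace X. locally_closed_at Y X q x \<and>
                                   compactin Y (Y frontier_of (fibre Y q x))}"

definition F_set :: "'a topology \<Rightarrow> 'b topology \<Rightarrow> ('a \<Rightarrow> 'b) \<Rightarrow> 'b set" where
  "F_set Y X q = {x \<in> topspace X. locally_closed_at Y X q x \<and>
                                   \<not> compactin Y (Y frontier_of (fibre Y q x))}"

definition N_set :: "'a topology \<Rightarrow> 'b topology \<Rightarrow> ('a \<Rightarrow> 'b) \<Rightarrow> 'b set" where
  "N_set Y X q = {x \<in> topspace X. \<not> locally_closed_at Y X q x}"

definition countably_tight_at :: "'b topology \<Rightarrow> 'b \<Rightarrow> bool" where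
  "countably_tight_at X x \<longleftrightarrow>
     (\<forall>A \<subseteq> topspace X. x \<in> X closure_of A \<longrightarrow>
        (\<exists>B \<subseteq> A. countable B \<and> x \<in> X closure_of B))"

definition countably_tight_space :: "'b topology \<Rightarrow> bool" where
  "countably_tight_space X \<longleftrightarrow> (\<forall>x \<in> topspace X. countably_tight_at X x)"

definition isolated_point_of :: "'b topology \<Rightarrow> 'b set \<Rightarrow> 'b \<Rightarrow> bool" where
  "isolated_point_of X S x \<longleftrightarrow> x \<in> S \<and> (\<exists>U. openin X U \<and> U \<inter> S = {x})"

definition directed_set :: "'i set \<Rightarrow> 'i rel \<Rightarrow> bool" where
  "directed_set I r \<longleftrightarrow> I \<noteq> {} \<and> preorder_on I r \<and>
     (\<forall>i\<in>I. \<forall>j\<in>I. \<exists>k\<in>I. (i, k) \<in> r \<and> (j, k) \<in> r)"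

definition net_to_infinity :: "'a topology \<Rightarrow> 'i set \<Rightarrow> 'i rel \<Rightarrow> ('i \<Rightarrow> 'a) \<Rightarrow> bool" where
  "net_to_infinity Y I r f \<longleftrightarrow>
     (\<forall>K. compactin Y K \<longrightarrow> (\<exists>i\<^sub>0\<in>I. \<forall>i\<in>I. (i\<^sub>0, i) \<in> r \<longrightarrow> f i \<notin> K))"

text \<open>The net condition in the definition of purity, restricted to nets whose index sets are subsets of the type \<open>'i\<close>.\<close>

definition nets_escape :: "'i itself \<Rightarrow> 'a topology \<Rightarrow> ('a \<Rightarrow> 'b) \<Rightarrow> 'a set \<Rightarrow> bool" where
  "nets_escape (_ :: 'i itself) Y q D \<longleftrightarrow>
     (\<forall>(I :: 'i set) r d e.
        directed_set I r \<longrightarrow> d \<in> I \<rightarrow> D \<longrightarrow> net_to_infinity Y I r d \<longrightarrow>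
        e \<in> I \<rightarrow> topspace Y \<longrightarrow> (\<forall>i\<in>I. q (e i) = q (d i)) \<longrightarrow>
        net_to_infinity Y I r e)"

text \<open>A definition cannot quantify over index types. Nets indexed by subsets of \<open>'a set\<close>
  (in particular by the compact subsets of \<open>Y\<close>) already imply the condition for every
  index type.\<close>

lemma nets_escape_any_index:
  assumes "nets_escape TYPE('a set) (Y :: 'a topology) q D"
  shows "nets_escape TYPE('i) Y q D"
proof -
  have key: "\<exists>K'. compactin Y K' \<and>
      (\<forall>d e. d \<in> D - K' \<longrightarrow> e \<in> topspace Y \<longrightarrow> q e = q d \<longrightarrow> e \<notin> K)"
    if K: "compactin Y K" for K
  proof (rule ccontr)
    assume "\<not> ?thesis"
    then have "\<forall>K'. \<exists>d e. compactin Y K' \<longrightarrow>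
        d \<in> D \<and> d \<notin> K' \<and> e \<in> topspace Y \<and> q e = q d \<and> e \<in> K"
      by blast
    then obtain d e where de: "\<And>K'. compactin Y K' \<Longrightarrow>
        d K' \<in> D \<and> d K' \<notin> K' \<and> e K' \<in> topspace Y \<and> q (e K') = q (d K') \<and> e K' \<in> K"
      by metis
    define I where "I = {K'. compactin Y K'}"
    define r where "r = {(A, B). A \<in> I \<and> B \<in> I \<and> A \<subseteq> B}"
    have Un: "A \<union> B \<in> I" if "A \<in> I" "B \<in> I" for A B
      using that unfolding I_def by (simp add: compactin_Un)
    have dir: "directed_set I r"
      unfolding directed_set_def preorder_on_def
    proof (intro conjI ballI)
      show "I \<noteq> {}" using K by (auto simp: I_def)
      show "r \<subseteq> I \<times> I" "refl_on I r" "trans r"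
        by (auto simp: r_def refl_on_def trans_def)
      show "\<exists>k\<in>I. (i, k) \<in> r \<and> (j, k) \<in> r" if "i \<in> I" "j \<in> I" for i j
        using Un[OF that] that by (intro bexI[of _ "i \<union> j"]) (auto simp: r_def)
    qed
    have "net_to_infinity Y I r d"
      unfolding net_to_infinity_def
    proof (intro allI impI)
      fix C assume "compactin Y C"
      then show "\<exists>i\<^sub>0\<in>I. \<forall>i\<in>I. (i\<^sub>0, i) \<in> r \<longrightarrow> d i \<notin> C"
        using de by (intro bexI[of _ C]) (auto simp: I_def r_def)
    qed
    moreover have "d \<in> I \<rightarrow> D" "e \<in> I \<rightarrow> topspace Y" "\<forall>i\<in>I. q (e i) = q (d i)"
      using de by (auto simp: I_def)
    ultimately have "net_to_infinity Y I r e"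
      using assms dir unfolding nets_escape_def by blast
    then obtain i where "i \<in> I" "\<forall>j\<in>I. (i, j) \<in> r \<longrightarrow> e j \<notin> K"
      using K unfolding net_to_infinity_def by blast
    then show False
      using de[of i] by (auto simp: I_def r_def)
  qed
  show ?thesis
    unfolding nets_escape_def
  proof (intro allI impI)
    fix I :: "'i set" and r d e
    assume d: "d \<in> I \<rightarrow> D" and inf: "net_to_infinity Y I r d"
      and e: "e \<in> I \<rightarrow> topspace Y" and eq: "\<forall>i\<in>I. q (e i) = q (d i)"
    show "net_to_infinity Y I r e"
      unfolding net_to_infinity_def
    proof (intro allI impI)
      fix K assume "compactin Y K"
      then obtain K' where K': "compactin Y K'"
        "\<And>d e. d \<in> D - K' \<Longrightarrow> e \<in> topspace Y \<Longrightarrow> q e = q d \<Longrightarrow> e \<notin> K"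
        using key by blast
      then obtain i0 where i0: "i0 \<in> I" "\<forall>i\<in>I. (i0, i) \<in> r \<longrightarrow> d i \<notin> K'"
        using inf unfolding net_to_infinity_def by blast
      have "e i \<notin> K" if "i \<in> I" "(i0, i) \<in> r" for i
        using K'(2)[of "d i" "e i"] that i0 d e eq by (auto simp: Pi_iff)
      then show "\<exists>i\<^sub>0\<in>I. \<forall>i\<in>I. (i\<^sub>0, i) \<in> r \<longrightarrow> e i \<notin> K"
        using i0(1) by blast
    qed
  qed
qed

definition pure_quotient_map :: "'a topology \<Rightarrow> 'b topology \<Rightarrow> ('a \<Rightarrow> 'b) \<Rightarrow> bool" where
  "pure_quotient_map Y X q \<longleftrightarrow> quotient_map Y X q \<and>
     (\<exists>D \<subseteq> topspace Y. Y closure_of D = topspace Y \<and> inj_on q D \<and>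
        nets_escape TYPE('a set) Y q D)"

end

theory Submission
  imports Defs
begin

text \<open>Let \<open>q\<close> be locally closed at \<open>x\<close>, and suppose that \<open>x\<close> is a limit of countably many points
  \<open>b\<^sub>0, b\<^sub>1, \<dots>\<close> of \<open>F\<^sub>q \<union> N\<^sub>q\<close> other than \<open>x\<close>. Exhaust \<open>Y\<close> by the interiors of compact sets \<open>K\<^sub>n\<close>.
  Each \<open>b\<^sub>n\<close> lies in the closure of \<open>q(W\<^sub>n)\<close> for a closed set \<open>W\<^sub>n\<close> which avoids both the fibre of \<open>x\<close>
  and the interior of \<open>K\<^sub>n\<close>: if \<open>b\<^sub>n \<in> F\<^sub>q\<close>, a point of the non-compact fibre of \<open>b\<^sub>n\<close> outside \<open>K\<^sub>n\<close> will do;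
  if \<open>b\<^sub>n \<in> N\<^sub>q\<close>, truncate a witness of non-local-closedness. The union of the \<open>W\<^sub>n\<close> is locally
  finite, hence closed, and contradicts local closedness at \<open>x\<close>.
  Thus \<open>x\<close> has a neighbourhood in which every other point belongs to \<open>L\<^sub>q\<close>.\<close>

lemma sigma_compact_exhaustion:
  assumes "locally_compact_space Y" "sigma_compact_space Y" "Hausdorff_space Y"
  obtains U K :: "nat \<Rightarrow> 'a set"
  where "\<And>n. openin Y (U n)" "\<And>n. compactin Y (K n)" "\<And>n. U n \<subseteq> K n"
    "incseq U" "(\<Union>n. U n) = topspace Y"
proof -
  obtain \<C> where \<C>: "countable \<C>" "\<forall>C\<in>\<C>. compactin Y C" "\<Union>\<C> = topspace Y"
    using assms(2) unfolding sigma_compact_space_def by (elim exE conjE)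
  \<comment> \<open>Inserting the empty set makes the family non-empty, so that
    \<open>from_nat_into\<close> enumerates exactly its members.\<close>
  define C where "C = from_nat_into (insert {} \<C>)"
  have range_C: "range C = insert {} \<C>"
    unfolding C_def using \<C>(1) by (intro range_from_nat_into) auto
  have "compactin Y (C n)" for n
    using rangeI[of C n] \<C>(2) unfolding range_C by auto
  then have "\<forall>n. \<exists>V L. openin Y V \<and> compactin Y L \<and> C n \<subseteq> V \<and> V \<subseteq> L"
    using assms(1,3) locally_compact_space_compact_closed_compact[of Y] by meson
  then obtain V L where VL: "\<And>n. openin Y (V n)" "\<And>n. compactin Y (L n)"
      "\<And>n. C n \<subseteq> V n" "\<And>n. V n \<subseteq> L n"
    by metis
  show ?thesis
  proof
    show "openin Y (\<Union>i\<le>n. V i)" for n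
      using VL(1) by blast
    show "compactin Y (\<Union>i\<le>n. L i)" for n
      using VL(2) by (intro compactin_Union) auto
    show "(\<Union>i\<le>n. V i) \<subseteq> (\<Union>i\<le>n. L i)" for n
      using VL(4) by blast
    show "incseq (\<lambda>n. \<Union>i\<le>n. V i)"
      unfolding incseq_def by fastforce
    have "topspace Y \<subseteq> (\<Union>n. C n)"
      using \<C>(3) range_C by auto
    also have "\<dots> \<subseteq> (\<Union>n. \<Union>i\<le>n. V i)"
      using VL(3) by blast
    finally show "(\<Union>n. \<Union>i\<le>n. V i) = topspace Y"
      using VL(1) openin_subset by fastforce
  qed
qed

text \<open>Points of the Hausdorff space \<open>X\<close> are closed, so a fibre is closed and
  contains its frontier. A fibre inside \<open>K\<close> would thus have a compact frontier.\<close>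

lemma fibre_not_subset_compactin:
  assumes Y: "Hausdorff_space Y" and X: "Hausdorff_space X" and q: "continuous_map Y X q"
    and b: "b \<in> F_set Y X q" and K: "compactin Y K"
  shows "\<not> fibre Y q b \<subseteq> K"
proof
  assume sub: "fibre Y q b \<subseteq> K"
  have "closedin X {b}"
    using X b by (simp add: F_set_def closedin_Hausdorff_singleton)
  then have "closedin Y (fibre Y q b)"
    using closedin_continuous_map_preimage[OF q] unfolding fibre_def by fastforce
  then have "Y frontier_of (fibre Y q b) \<subseteq> K"
    using sub frontier_of_subset_closedin by blast
  then have "compactin Y (Y frontier_of (fibre Y q b))"
    using K closed_compactin closedin_frontier_of by blast
  with b show False
    by (simp add: F_set_def)
qed

lemma F_N_closed_witness:
  assumes Y: "Hausdorff_space Y" and X: "Hausdorff_space X" and q: "continuous_map Y X q"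
    and b: "b \<in> F_set Y X q \<union> N_set Y X q" and x: "x \<in> topspace X" "b \<noteq> x"
    and U: "openin Y U" "U \<subseteq> K" and K: "compactin Y K"
  shows "\<exists>W. closedin Y W \<and> W \<inter> U = {} \<and> x \<notin> q ` W \<and> b \<in> X closure_of (q ` W)"
proof (cases "b \<in> F_set Y X q")
  case True
  then obtain w where w: "w \<in> topspace Y" "q w = b" "w \<notin> K"
    using fibre_not_subset_compactin[OF Y X q True K] by (auto simp: fibre_def)
  have "b \<in> topspace X"
    using True by (simp add: F_set_def)
  then have "closedin Y {w}" "{w} \<inter> U = {}" "x \<notin> q ` {w}" "b \<in> X closure_of (q ` {w})"
    using w Y U(2) x(2) closure_of_subset[of "{b}" X]
    by (auto simp: closedin_Hausdorff_singleton)
  then show ?thesis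
    by blast
next
  case False
  then obtain W where bX: "b \<in> topspace X" and W: "closedin Y W" "b \<in> X closure_of (q ` W)" "b \<notin> q ` W"
    using b unfolding N_set_def locally_closed_at_def by blast
  obtain S T where ST: "openin X S" "openin X T" "x \<in> S" "b \<in> T" "disjnt S T"
    using X x bX unfolding Hausdorff_space_def by metis
  \<comment> \<open>Removing the preimage of \<open>S\<close> keeps the image away from
    \<open>x\<close>; removing \<open>U\<close> pushes the set outwards. Both removed sets are open,
    so \<open>W'\<close> stays closed.\<close>
  define W' where "W' = (W \<inter> {y \<in> topspace Y. q y \<in> topspace X - S}) - U"
  have "closedin Y {y \<in> topspace Y. q y \<in> topspace X - S}"
    using q ST(1) by (intro closedin_continuous_map_preimage[OF q]) auto
  then have cl: "closedin Y W'"
    unfolding W'_def using W(1) U(1) by (intro closedin_diff closedin_Int) auto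
  have "compactin Y (W \<inter> K)"
    using W(1) K closed_Int_compactin by blast
  then have qWK: "closedin X (q ` (W \<inter> K))"
    using X q compactin_imp_closedin image_compactin by blast
  have "b \<in> X closure_of (q ` W')"
    unfolding in_closure_of
  proof (intro conjI allI impI)
    fix P assume P: "b \<in> P \<and> openin X P"
    \<comment> \<open>The image of \<open>W \<inter> K\<close> is compact, hence closed, and misses
      \<open>b\<close>, so it can be cut out of any neighbourhood of \<open>b\<close>. A point of
      \<open>W\<close> mapped into the rest lies outside \<open>K\<close>, hence outside
      \<open>U\<close>; the factor \<open>T\<close> keeps its image out of \<open>S\<close>.\<close>
    let ?P = "(P \<inter> T) - q ` (W \<inter> K)"
    have "openin X ?P" "b \<in> ?P"
      using P ST qWK W(3) by auto
    then obtain w where w: "w \<in> W" "q w \<in> ?P"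
      using W(2) unfolding in_closure_of by (metis imageE)
    have "w \<in> topspace Y"
      using w(1) closedin_subset[OF W(1)] by blast
    then have "q w \<in> topspace X"
      using q by (auto simp: continuous_map_def)
    moreover have "q w \<notin> S" "w \<notin> K"
      using w ST(5) by (auto simp: disjnt_iff)
    ultimately have "w \<in> W'"
      using w(1) \<open>w \<in> topspace Y\<close> U(2) by (auto simp: W'_def)
    with w show "\<exists>y. y \<in> q ` W' \<and> y \<in> P"
      by blast
  qed (fact bX)
  moreover have "x \<notin> q ` W'" "W' \<inter> U = {}"
    using ST(3) by (auto simp: W'_def)
  ultimately show ?thesis
    using cl by blast
qed

text \<open>As \<open>U\<close> increases, \<open>U n\<close> can meet \<open>W b\<close> only if
  \<open>g b < n\<close>, and injectivity of \<open>g\<close> leaves finitely many such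
  \<open>b\<close>. The family is therefore locally finite.\<close>

lemma closedin_Union_escaping:
  fixes g :: "'b \<Rightarrow> nat"
  assumes U: "\<And>n. openin Y (U n)" "incseq U" "(\<Union>n. U n) = topspace Y"
    and g: "inj_on g B"
    and W: "\<And>b. b \<in> B \<Longrightarrow> closedin Y (W b)" "\<And>b. b \<in> B \<Longrightarrow> W b \<inter> U (g b) = {}"
  shows "closedin Y (\<Union>b\<in>B. W b)"
proof (rule closedin_locally_finite_Union)
  show "closedin Y S" if "S \<in> W ` B" for S
    using that W(1) by blast
  show "locally_finite_in Y (W ` B)"
    unfolding locally_finite_in_def
  proof (intro conjI ballI)
    show "\<Union> (W ` B) \<subseteq> topspace Y"
      using W(1) closedin_subset by blast
    fix y assume "y \<in> topspace Y"
    then obtain n where n: "y \<in> U n"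
      using U(3) by blast
    have "g b < n" if "b \<in> B" "W b \<inter> U n \<noteq> {}" for b
      using W(2)[OF that(1)] that(2) incseqD[OF U(2), of n "g b"] by (meson disjoint_iff not_less subsetD)
    then have "{S \<in> W ` B. S \<inter> U n \<noteq> {}} \<subseteq> W ` {b \<in> B. g b < n}"
      by blast
    moreover have "{b \<in> B. g b < n} = g -` {..<n} \<inter> B"
      by auto
    then have "finite {b \<in> B. g b < n}"
      using finite_vimage_IntI[OF finite_lessThan g] by simp
    ultimately have "finite {S \<in> W ` B. S \<inter> U n \<noteq> {}}"
      using finite_surj by blast
    then show "\<exists>V. openin Y V \<and> y \<in> V \<and> finite {S \<in> W ` B. S \<inter> V \<noteq> {}}"
      using U(1) n by blast
  qed
qed

text \<open>Both parts of the theorem rest on this: at a point of \<open>F_set\<close> it gives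
  isolation, and at every point outside \<open>N_set\<close> it gives a neighbourhood missing
  \<open>N_set\<close>.\<close>

proposition locally_closed_at_neighbourhood:
  assumes Y: "locally_compact_space Y" "sigma_compact_space Y" "Hausdorff_space Y"
    and X: "Hausdorff_space X" and q: "continuous_map Y X q"
    and x: "x \<in> topspace X" "locally_closed_at Y X q x" "countably_tight_at X x"
  shows "\<exists>T. openin X T \<and> x \<in> T \<and> T - {x} \<subseteq> L_set Y X q"
proof (rule ccontr)
  assume no_nbhd: "\<not> ?thesis"
  define A where "A = F_set Y X q \<union> N_set Y X q - {x}"
  have "A \<subseteq> topspace X"
    by (auto simp: A_def F_set_def N_set_def)
  moreover have "x \<in> X closure_of A"
    unfolding in_closure_of
  proof (intro conjI allI impI)
    fix T assume T: "x \<in> T \<and> openin X T"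
    then obtain y where "y \<in> T" "y \<noteq> x" "y \<notin> L_set Y X q"
      using no_nbhd by blast
    moreover from this T have "y \<in> topspace X"
      using openin_subset by blast
    ultimately show "\<exists>y. y \<in> A \<and> y \<in> T"
      by (auto simp: A_def F_set_def N_set_def L_set_def)
  qed (fact x(1))
  ultimately obtain B where B: "B \<subseteq> A" "countable B" "x \<in> X closure_of B"
    using x(3) unfolding countably_tight_at_def by blast
  \<comment> \<open>The injection serves as a numbering of \<open>B\<close>, finite or infinite: it
    decides which \<open>U n\<close> the set chosen for \<open>b\<close> must avoid.\<close>
  obtain g :: "'b \<Rightarrow> nat" where g: "inj_on g B"
    using B(2) countableE by blast
  obtain U K where UK: "\<And>n. openin Y (U n)" "\<And>n. compactin Y (K n)" "\<And>n. U n \<subseteq> K n"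
    "incseq U" "(\<Union>n. U n) = topspace Y"
    using sigma_compact_exhaustion[OF Y] by metis
  have "\<exists>W. closedin Y W \<and> W \<inter> U (g b) = {} \<and> x \<notin> q ` W \<and> b \<in> X closure_of (q ` W)"
    if "b \<in> B" for b
    using that B(1) x(1) UK(1-3)
    by (intro F_N_closed_witness[OF Y(3) X q, where K = "K (g b)"]) (auto simp: A_def)
  then obtain W where W: "\<And>b. b \<in> B \<Longrightarrow> closedin Y (W b)" "\<And>b. b \<in> B \<Longrightarrow> W b \<inter> U (g b) = {}"
      "\<And>b. b \<in> B \<Longrightarrow> x \<notin> q ` W b" "\<And>b. b \<in> B \<Longrightarrow> b \<in> X closure_of (q ` W b)"
    by metis
  have "closedin Y (\<Union>b\<in>B. W b)"
    using closedin_Union_escaping[OF UK(1,4,5) g] W(1,2) by blast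
  \<comment> \<open>The closure of the image of the union contains \<open>B\<close>, hence also the
    closure of \<open>B\<close>, where \<open>x\<close> lies.\<close>
  moreover have "B \<subseteq> X closure_of (q ` (\<Union>b\<in>B. W b))"
    using W(4) closure_of_mono[of "q ` W _" "q ` (\<Union>b\<in>B. W b)" X] by blast
  then have "x \<in> X closure_of (q ` (\<Union>b\<in>B. W b))"
    using B(3) closure_of_minimal closedin_closure_of by blast
  ultimately have "x \<in> q ` (\<Union>b\<in>B. W b)"
    using x(2) unfolding locally_closed_at_def by blast
  then show False
    using W(3) by blast
qed

text \<open>The fibre over an isolated point is clopen, so its frontier is empty and in particular
  compact.\<close>

lemma F_set_not_open_singleton:
  assumes q: "continuous_map Y X q" and X: "Hausdorff_space X" and x: "x \<in> F_set Y X q"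
  shows "\<not> openin X {x}"
proof
  assume "openin X {x}"
  moreover have "closedin X {x}"
    using X x by (simp add: F_set_def closedin_Hausdorff_singleton)
  ultimately have "openin Y (fibre Y q x)" "closedin Y (fibre Y q x)"
    using openin_continuous_map_preimage[OF q] closedin_continuous_map_preimage[OF q]
    unfolding fibre_def by fastforce+
  then have "Y frontier_of (fibre Y q x) = {}"
    by (simp add: frontier_of_eq_empty openin_subset)
  with x show False
    by (simp add: F_set_def)
qed

theorem corollary4p6:
  fixes Y :: "'a topology" and X :: "'b topology" and q :: "'a \<Rightarrow> 'b"
  assumes "locally_compact_space Y" and "sigma_compact_space Y" and "Hausdorff_space Y"
    and "Hausdorff_space X" and "pure_quotient_map Y X q"
  shows "(\<forall>x \<in> F_set Y X q. countably_tight_at X x \<longrightarrow>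
            isolated_point_of X (F_set Y X q \<union> N_set Y X q) x \<and>
            x \<in> X closure_of (L_set Y X q)) \<and>
         (countably_tight_space X \<longrightarrow>
            closedin X (N_set Y X q) \<and>
            subtopology X (F_set Y X q) = discrete_topology (F_set Y X q) \<and>
            F_set Y X q \<subseteq> X closure_of (L_set Y X q))"
proof -
  have q: "continuous_map Y X q"
    using assms(5) quotient_imp_continuous_map unfolding pure_quotient_map_def by blast
  note nbhd = locally_closed_at_neighbourhood[OF assms(1-4) q]
  have disj: "L_set Y X q \<inter> (F_set Y X q \<union> N_set Y X q) = {}" "F_set Y X q \<inter> N_set Y X q = {}"
    by (auto simp: L_set_def F_set_def N_set_def)
  have part1: "isolated_point_of X (F_set Y X q \<union> N_set Y X q) x \<and> x \<in> X closure_of (L_set Y X q)"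
    if x: "x \<in> F_set Y X q" and tight: "countably_tight_at X x" for x
  proof
    obtain T where T: "openin X T" "x \<in> T" "T - {x} \<subseteq> L_set Y X q"
      using nbhd[OF _ _ tight] x by (auto simp: F_set_def)
    then have "T \<inter> (F_set Y X q \<union> N_set Y X q) = {x}"
      using x disj by blast
    then show "isolated_point_of X (F_set Y X q \<union> N_set Y X q) x"
      using x T(1) unfolding isolated_point_of_def by blast
    show "x \<in> X closure_of (L_set Y X q)"
      unfolding in_closure_of
    proof (intro conjI allI impI)
      show "x \<in> topspace X"
        using x by (simp add: F_set_def)
      fix P assume P: "x \<in> P \<and> openin X P"
      \<comment> \<open>Since \<open>x\<close> is not isolated in \<open>X\<close>,
        \<open>P \<inter> T\<close> has a second point, and every point of \<open>T\<close> other
        than \<open>x\<close> is in \<open>L_set\<close>.\<close>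
      then have "P \<inter> T \<noteq> {x}"
        using F_set_not_open_singleton[OF q assms(4) x] T(1) by (metis openin_Int)
      then show "\<exists>y. y \<in> L_set Y X q \<and> y \<in> P"
        using P T by blast
    qed
  qed
  moreover have "closedin X (N_set Y X q)" if tight: "countably_tight_space X"
    unfolding closedin_def
  proof
    show "N_set Y X q \<subseteq> topspace X"
      by (auto simp: N_set_def)
    show "openin X (topspace X - N_set Y X q)"
    proof (subst openin_subopen, intro ballI)
      fix x assume x: "x \<in> topspace X - N_set Y X q"
      then obtain T where T: "openin X T" "x \<in> T" "T - {x} \<subseteq> L_set Y X q"
        using nbhd[of x] tight by (auto simp: N_set_def countably_tight_space_def)
      \<comment> \<open>\<open>T\<close> consists of \<open>x\<close>, which is not in
        \<open>N_set\<close>, and of points of \<open>L_set\<close>, which is disjoint from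
        \<open>N_set\<close>.\<close>
      then have "T \<subseteq> topspace X - N_set Y X q"
        using x disj openin_subset[OF T(1)] by blast
      then show "\<exists>T. openin X T \<and> x \<in> T \<and> T \<subseteq> topspace X - N_set Y X q"
        using T by blast
    qed
  qed
  moreover have "subtopology X (F_set Y X q) = discrete_topology (F_set Y X q)"
    if tight: "countably_tight_space X"
  proof -
    have FX: "F_set Y X q \<subseteq> topspace X"
      by (auto simp: F_set_def)
    have "openin (subtopology X (F_set Y X q)) {x}" if x: "x \<in> F_set Y X q" for x
    proof -
      obtain T where T: "openin X T" "T \<inter> (F_set Y X q \<union> N_set Y X q) = {x}"
        using part1[OF x] x FX tight unfolding isolated_point_of_def countably_tight_space_def by blast
      then have "{x} = T \<inter> F_set Y X q"
        using x by blast
      then show ?thesis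
        using T(1) unfolding openin_subtopology by blast
    qed
    then show ?thesis
      using FX discrete_topology_unique[of "F_set Y X q" "subtopology X (F_set Y X q)"]
      by (metis topspace_subtopology_subset)
  qed
  moreover have "F_set Y X q \<subseteq> X closure_of (L_set Y X q)" if "countably_tight_space X"
    using part1 that by (auto simp: countably_tight_space_def F_set_def)
  ultimately show ?thesis
    by blast
qed

end
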